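(* For all integers $t \geq 3$ and $n \geq 1$, $\rho(n, C_t) = \lceil n/(t-1) \rceil$.
   Context: An orthonormal representation of a graph $G$ in $\mathbb{R}^d$ is a map $f: V(G) \to \mathbb{R}^d$ with $\|f(u)\|=1$ for all $u$ and $\langle f(u), f(v)\rangle = 0$ for all distinct non-adjacent $u,v$ (distinct vertices may receive the same vector). The minimum semidefinite rank $\mathrm{msr}(G)$ is the minimum $d$ such that $G$ has an orthonormal representation in $\mathbb{R}^d$. A graph is $H$-free if it contains no subgraph isomorphic to $H$. $\rho(n,H)$ is the minimum of $\mathrm{msr}(G)$ over all $H$-free simple graphs $G$ on $n$ vertices. $C_t$ is the cycle of length $t$. *)

theory Defs
  imports "Graph_Theory.Graph_Theory" "Jordan_Normal_Form.Matrix"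
begin

text \<open>
  A finite simple graph is a \<^locale>\<open>pair_graph\<close>: each edge is represented by its two
  opposite arcs, and there are no loops.
\<close>

definition cycle_graph :: "nat \<Rightarrow> nat pair_pre_digraph" where
  "cycle_graph t = \<lparr> pverts = {..<t},
     parcs = {(u, v). u < t \<and> v < t \<and> (v = Suc u mod t \<or> u = Suc v mod t)} \<rparr>"

text \<open>Subgraphs are not required to be induced.\<close>

definition H_free :: "'h pair_pre_digraph \<Rightarrow> 'v pair_pre_digraph \<Rightarrow> bool" where
  "H_free H G \<longleftrightarrow> \<not> (\<exists>K. pair_graph K \<and> subgraph (with_proj K) (with_proj G)
     \<and> digraph_iso (with_proj H) (with_proj K))"

definition euclidean_norm :: "real vec \<Rightarrow> real" where
  "euclidean_norm x = sqrt (x \<bullet> x)"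

definition orthonormal_representation ::
    "'v pair_pre_digraph \<Rightarrow> nat \<Rightarrow> ('v \<Rightarrow> real vec) \<Rightarrow> bool" where
  "orthonormal_representation G d f \<longleftrightarrow>
     (\<forall>u\<in>pverts G. f u \<in> carrier_vec d \<and> euclidean_norm (f u) = 1) \<and>
     (\<forall>u\<in>pverts G. \<forall>v\<in>pverts G. u \<noteq> v \<and> (u, v) \<notin> parcs G \<longrightarrow> f u \<bullet> f v = 0)"

definition msr :: "'v pair_pre_digraph \<Rightarrow> nat" where
  "msr G = (LEAST d. \<exists>f. orthonormal_representation G d f)"

text \<open>
  Every finite graph has an isomorphic copy with vertices in \<^typ>\<open>nat\<close>, so fixing this
  vertex type does not change the minimum.
\<close>

definition rho :: "nat \<Rightarrow> 'h pair_pre_digraph \<Rightarrow> nat" where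
  "rho n H = (LEAST m. \<exists>G :: nat pair_pre_digraph.
     pair_graph G \<and> card (pverts G) = n \<and> H_free H G \<and> msr G = m)"

end

theory Submission
  imports Defs "HOL-Analysis.Convex"
begin

text \<open>
  In a \<open>C\<^sub>t\<close>-free graph no neighbourhood contains a path on \<open>t - 1\<close> vertices, so every
  neighbourhood splits into \<open>t - 2\<close> independent sets. By Bessel's inequality, each of these contributes
  at most 1 to \<open>\<Sum>u. \<langle>f u, f v\<rangle>\<^sup>2\<close>, and \<open>u = v\<close> contributes another 1, so the sum is at
  most \<open>t - 1\<close>. On the other hand, \<open>n\<close> unit vectors in dimension \<open>d\<close> satisfy the Welch bound
  \<open>n\<^sup>2 \<le> d * (\<Sum>u v. \<langle>f u, f v\<rangle>\<^sup>2)\<close>, whence \<open>n \<le> d * (t - 1)\<close>.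
  Disjoint cliques on \<open>t - 1\<close> vertices, each mapped to its own basis vector, attain the bound.
\<close>

section \<open>Inequalities for finite families of real vectors\<close>

text \<open>Vectors are functions on a finite index set \<open>D\<close>. With \<open>p\<close> the
  orthogonal projection of \<open>w\<close> onto the span of the \<open>g u\<close>, the claim is
  that the squared norm of \<open>w - p\<close> is nonnegative.\<close>

lemma bessel_inequality:
  fixes g :: "'a \<Rightarrow> 'i \<Rightarrow> real"
  assumes "finite D" "finite I"
    and orth: "\<And>u v. u \<in> I \<Longrightarrow> v \<in> I \<Longrightarrow> (\<Sum>i\<in>D. g u i * g v i) = (if u = v then 1 else 0)"
  shows "(\<Sum>u\<in>I. (\<Sum>i\<in>D. g u i * w i)\<^sup>2) \<le> (\<Sum>i\<in>D. (w i)\<^sup>2)"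
proof -
  define c where "c u = (\<Sum>i\<in>D. g u i * w i)" for u
  define p where "p i = (\<Sum>u\<in>I. c u * g u i)" for i
  have "(\<Sum>i\<in>D. w i * p i) = (\<Sum>u\<in>I. c u * (\<Sum>i\<in>D. g u i * w i))"
    unfolding p_def sum_distrib_left
    by (subst sum.swap) (intro sum.cong refl, simp add: mult_ac)
  also have "\<dots> = (\<Sum>u\<in>I. (c u)\<^sup>2)"
    by (simp add: c_def power2_eq_square)
  finally have wp: "(\<Sum>i\<in>D. w i * p i) = (\<Sum>u\<in>I. (c u)\<^sup>2)" .
  have "(\<Sum>i\<in>D. (p i)\<^sup>2) = (\<Sum>i\<in>D. \<Sum>u\<in>I. \<Sum>v\<in>I. c u * c v * (g u i * g v i))"
    unfolding p_def power2_eq_square sum_product by (intro sum.cong refl) (simp add: mult_ac)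
  also have "\<dots> = (\<Sum>u\<in>I. \<Sum>v\<in>I. \<Sum>i\<in>D. c u * c v * (g u i * g v i))"
    by (subst sum.swap, rule sum.cong[OF refl], rule sum.swap)
  also have "\<dots> = (\<Sum>u\<in>I. \<Sum>v\<in>I. c u * c v * (if u = v then 1 else 0))"
    unfolding sum_distrib_left[symmetric] by (intro sum.cong refl) (simp add: orth)
  also have "\<dots> = (\<Sum>u\<in>I. (c u)\<^sup>2)"
    using \<open>finite I\<close> by (intro sum.cong refl) (simp add: if_distrib sum.delta power2_eq_square cong: if_cong)
  finally have pp: "(\<Sum>i\<in>D. (p i)\<^sup>2) = (\<Sum>u\<in>I. (c u)\<^sup>2)" .
  \<comment> \<open>Both the inner product of \<open>w\<close> with \<open>p\<close> and the squared
    norm of \<open>p\<close> equal the sum of the squared coefficients, so the expansion collapses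
    to the difference of the two sides.\<close>
  have "0 \<le> (\<Sum>i\<in>D. (w i - p i)\<^sup>2)"
    by (intro sum_nonneg) simp
  also have "\<dots> = (\<Sum>i\<in>D. (w i)\<^sup>2) + (\<Sum>i\<in>D. (p i)\<^sup>2) - 2 * (\<Sum>i\<in>D. w i * p i)"
    by (simp add: power2_diff sum.distrib sum_subtractf sum_distrib_left mult.assoc)
  finally show ?thesis
    using wp pp by (simp add: c_def)
qed

text \<open>The Gram matrix and the matrix \<open>S\<close>, the sum of the outer products of the
  \<open>g u\<close> with themselves, have the same trace and the same Frobenius norm.
  Cauchy-Schwarz on the diagonal of \<open>S\<close> bounds the squared trace by
  \<open>card D\<close> times the squared Frobenius norm.\<close>

lemma welch_bound:
  fixes g :: "'a \<Rightarrow> 'i \<Rightarrow> real"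
  assumes "finite D" "finite V"
  shows "(\<Sum>u\<in>V. \<Sum>i\<in>D. (g u i)\<^sup>2)\<^sup>2
    \<le> card D * (\<Sum>u\<in>V. \<Sum>v\<in>V. (\<Sum>i\<in>D. g u i * g v i)\<^sup>2)"
proof -
  define S where "S i j = (\<Sum>u\<in>V. g u i * g u j)" for i j
  have "(\<Sum>u\<in>V. \<Sum>v\<in>V. (\<Sum>i\<in>D. g u i * g v i)\<^sup>2)
      = (\<Sum>u\<in>V. \<Sum>v\<in>V. \<Sum>i\<in>D. \<Sum>j\<in>D. (g u i * g u j) * (g v i * g v j))"
    unfolding power2_eq_square sum_product by (intro sum.cong refl) (simp add: mult_ac)
  also have "\<dots> = (\<Sum>u\<in>V. \<Sum>i\<in>D. \<Sum>j\<in>D. \<Sum>v\<in>V. (g u i * g u j) * (g v i * g v j))"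
    by (rule sum.cong[OF refl], subst sum.swap, rule sum.cong[OF refl], rule sum.swap)
  also have "\<dots> = (\<Sum>i\<in>D. \<Sum>j\<in>D. \<Sum>u\<in>V. \<Sum>v\<in>V. (g u i * g u j) * (g v i * g v j))"
    by (subst sum.swap, rule sum.cong[OF refl], rule sum.swap)
  also have "\<dots> = (\<Sum>i\<in>D. \<Sum>j\<in>D. (S i j)\<^sup>2)"
    unfolding S_def power2_eq_square sum_product ..
  finally have frob: "(\<Sum>u\<in>V. \<Sum>v\<in>V. (\<Sum>i\<in>D. g u i * g v i)\<^sup>2) = (\<Sum>i\<in>D. \<Sum>j\<in>D. (S i j)\<^sup>2)" .
  have "(\<Sum>u\<in>V. \<Sum>i\<in>D. (g u i)\<^sup>2) = (\<Sum>i\<in>D. S i i)"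
    unfolding S_def by (subst sum.swap) (simp add: power2_eq_square)
  then have "(\<Sum>u\<in>V. \<Sum>i\<in>D. (g u i)\<^sup>2)\<^sup>2 \<le> (\<Sum>i\<in>D. (S i i)\<^sup>2) * card D"
    using sum_squared_le_sum_of_squares by metis
  \<comment> \<open>Each squared diagonal entry is one term of the sum over its row.\<close>
  also have "\<dots> \<le> (\<Sum>i\<in>D. \<Sum>j\<in>D. (S i j)\<^sup>2) * card D"
    using \<open>finite D\<close> by (intro mult_right_mono sum_mono member_le_sum) auto
  finally show ?thesis
    by (simp add: frob mult.commute)
qed

section \<open>Colouring graphs without long paths\<close>

text \<open>
  An endpoint of a longest path has all its neighbours on that path, hence at most \<open>k - 1\<close> of
  them, and can be coloured last.
\<close>
lemma pathfree_colouring: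
  assumes "finite S" and sym: "\<And>u v. E u v \<Longrightarrow> E v u"
    and nopath: "\<And>xs. distinct xs \<Longrightarrow> set xs \<subseteq> S \<Longrightarrow> successively E xs \<Longrightarrow> length xs \<le> k"
  shows "\<exists>c. c ` S \<subseteq> {..<k} \<and> (\<forall>u\<in>S. \<forall>v\<in>S. u \<noteq> v \<longrightarrow> E u v \<longrightarrow> c u \<noteq> (c v :: nat))"
  using assms(1) nopath
proof (induction "card S" arbitrary: S)
  case 0
  then show ?case by auto
next
  case (Suc n)
  define P where "P xs \<longleftrightarrow> distinct xs \<and> set xs \<subseteq> S \<and> successively E xs" for xs
  obtain s where "s \<in> S" using Suc.hyps(2) by fastforce
  then have "P [s]" by (simp add: P_def)
  moreover have "\<forall>ys. P ys \<longrightarrow> length ys < Suc k"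
    using Suc.prems(2) by (auto simp: P_def le_imp_less_Suc)
  ultimately obtain xs where xs: "P xs" and max: "\<And>ys. P ys \<Longrightarrow> length ys \<le> length xs"
    using ex_has_greatest_nat[of P "[s]" length "Suc k"] by metis
  have "xs \<noteq> []" using max[OF \<open>P [s]\<close>] by auto
  then obtain x ys where xs_eq: "xs = x # ys" by (cases xs) auto
  have "x \<in> S" using xs by (simp add: P_def xs_eq)
  have "length xs \<le> k" using xs Suc.prems(2) by (auto simp: P_def)
  define N where "N = {v \<in> S. v \<noteq> x \<and> E x v}"
  have N: "N \<subseteq> set ys"
  proof
    fix v assume v: "v \<in> N"
    show "v \<in> set ys"
    proof (rule ccontr)
      assume "v \<notin> set ys"
      then have "P (v # xs)" using xs v sym[of x v] by (auto simp: P_def xs_eq N_def)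
      from max[OF this] show False by simp
    qed
  qed
  have "n = card (S - {x})" using Suc.hyps(2) Suc.prems(1) \<open>x \<in> S\<close> by simp
  then have "\<exists>c. c ` (S - {x}) \<subseteq> {..<k} \<and>
      (\<forall>u\<in>S - {x}. \<forall>v\<in>S - {x}. u \<noteq> v \<longrightarrow> E u v \<longrightarrow> c u \<noteq> (c v :: nat))"
  proof (rule Suc.hyps(1))
    show "finite (S - {x})" using Suc.prems(1) by simp
    show "length zs \<le> k" if "distinct zs" "set zs \<subseteq> S - {x}" "successively E zs" for zs
      using Suc.prems(2) that by blast
  qed
  then obtain c where c: "c ` (S - {x}) \<subseteq> {..<k}"
      "\<forall>u\<in>S - {x}. \<forall>v\<in>S - {x}. u \<noteq> v \<longrightarrow> E u v \<longrightarrow> c u \<noteq> (c v :: nat)"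
    by blast
  \<comment> \<open>The neighbours of \<open>x\<close> lie among the at most \<open>k - 1\<close>
    vertices of \<open>ys\<close>, so some colour \<open>j\<close> below \<open>k\<close> is left
    for \<open>x\<close>.\<close>
  have "card (c ` N) \<le> card N" using Suc.prems(1) by (intro card_image_le) (simp add: N_def)
  also have "\<dots> \<le> length ys" using N by (meson card_length card_mono finite_set order_trans)
  also have "\<dots> < card {..<k}" using \<open>length xs \<le> k\<close> by (simp add: xs_eq)
  finally have "\<not> {..<k} \<subseteq> c ` N"
    using Suc.prems(1) card_mono[of "c ` N" "{..<k}"] by (auto simp: N_def)
  then obtain j where j: "j < k" "j \<notin> c ` N" by blast
  have "\<forall>u\<in>S. \<forall>v\<in>S. u \<noteq> v \<longrightarrow> E u v \<longrightarrow> (c(x := j)) u \<noteq> (c(x := j)) v"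
    using c(2) j(2) by (auto simp: N_def image_iff dest: sym)
  moreover have "(c(x := j)) ` S \<subseteq> {..<k}" using c(1) j(1) by auto
  ultimately show ?case by blast
qed

section \<open>Recognising cycles as subgraphs\<close>

lemma finite_pair_graphI:
  assumes "finite (pverts G)" "parcs G \<subseteq> pverts G \<times> pverts G" "sym (parcs G)"
    and "\<And>u. (u, u) \<notin> parcs G"
  shows "pair_graph G"
proof -
  have "finite (parcs G)" using assms(1,2) by (meson finite_SigmaI finite_subset)
  with assms show ?thesis
    by unfold_locales (auto simp: symmetric_def)
qed

lemma Suc_mod_neq:
  assumes "2 \<le> t" "i < (t::nat)"
  shows "Suc i mod t \<noteq> i"
  using assms by (cases "Suc i = t") auto

lemma pair_graph_cycle_graph:
  assumes "2 \<le> t"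
  shows "pair_graph (cycle_graph t)"
  using Suc_mod_neq[OF assms] Suc_mod_neq[OF assms, THEN not_sym]
  by (intro finite_pair_graphI) (auto simp: cycle_graph_def sym_def)

text \<open>Reduces finding a copy of the cycle to listing its vertices in cyclic order:
  \<open>nth xs\<close> is injective on the indices and carries the cycle onto the subgraph
  \<open>K\<close>.\<close>

lemma not_H_free_cycle_graphI:
  assumes G: "pair_graph G" and "2 \<le> t" and "distinct xs" "length xs = t"
    and cyc: "\<And>i. i < t \<Longrightarrow> (xs ! i, xs ! (Suc i mod t)) \<in> parcs G"
  shows "\<not> H_free (cycle_graph t) G"
proof -
  interpret G: pair_graph G by fact
  interpret C: pair_graph "cycle_graph t" using \<open>2 \<le> t\<close> by (rule pair_graph_cycle_graph)
  let ?h = "map_prod (nth xs) (nth xs)"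
  define K where "K = \<lparr>pverts = nth xs ` pverts (cycle_graph t), parcs = ?h ` parcs (cycle_graph t)\<rparr>"
  have inj: "inj_on (nth xs) {..<t}" using assms(3,4) by (simp add: inj_on_nth)
  have arcs: "parcs (cycle_graph t) \<subseteq> {..<t} \<times> {..<t}" by (auto simp: cycle_graph_def)
  have verts: "pverts (cycle_graph t) = {..<t}" by (simp add: cycle_graph_def)
  \<comment> \<open>The assumption \<open>cyc\<close> gives one direction of each edge; symmetry of
    \<open>G\<close> gives the opposite arc.\<close>
  have sub: "parcs K \<subseteq> parcs G"
    using cyc G.arcs_symmetric by (auto simp: K_def cycle_graph_def)
  have K: "pair_graph K"
  proof (rule finite_pair_graphI)
    show "finite (pverts K)" by (simp add: K_def verts)
    show "parcs K \<subseteq> pverts K \<times> pverts K" using arcs by (auto simp: K_def verts)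
    show "sym (parcs K)"
      using C.arcs_symmetric by (fastforce simp: K_def sym_def)
    show "(u, u) \<notin> parcs K" for u using sub G.no_loops' by blast
  qed
  then interpret K: pair_graph K .
  have "pverts K \<subseteq> pverts G"
    using cyc G.in_arcsD1 by (auto simp: K_def verts)
  then have "subgraph (with_proj K) (with_proj G)"
    using sub K.wf_digraph G.wf_digraph by (auto simp: subgraph_def)
  moreover have "digraph_iso (with_proj (cycle_graph t)) (with_proj K)"
  proof -
    \<comment> \<open>The arcs of \<open>K\<close> are pairs, so the target tail and head maps are
      \<open>fst\<close> and \<open>snd\<close>.\<close>
    define f where "f = \<lparr>iso_verts = nth xs, iso_arcs = ?h, iso_head = snd, iso_tail = fst\<rparr>"
    have "inj_on ?h (parcs (cycle_graph t))"
      by (rule inj_on_subset[OF map_prod_inj_on[OF inj inj] arcs])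
    then have "pre_digraph.digraph_isomorphism (with_proj (cycle_graph t)) f"
      using C.wf_digraph inj verts by (auto simp: pre_digraph.digraph_isomorphism_def f_def)
    moreover have "with_proj K = app_iso f (with_proj (cycle_graph t))"
      by (auto simp: with_proj_def app_iso_def K_def f_def)
    ultimately show ?thesis unfolding digraph_iso_def by blast
  qed
  ultimately show ?thesis using K unfolding H_free_def by blast
qed

section \<open>Lower bound on the dimension\<close>

lemma H_free_cycle_graph_card_le:
  assumes G: "pair_graph G" and free: "H_free (cycle_graph t) G" and t: "3 \<le> t"
    and rep: "orthonormal_representation G d f"
  shows "card (pverts G) \<le> d * (t - 1)"
proof -
  interpret G: pair_graph G by fact
  define V where "V = pverts G"
  have finV: "finite V" by (simp add: V_def G.pair_finite_verts)
  define g where "g u i = f u $ i" for u i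
  define ip where "ip u v = (\<Sum>i<d. g u i * g v i)" for u v
  have ip: "ip u v = f u \<bullet> f v" if "u \<in> V" "v \<in> V" for u v
    using rep that
    by (auto simp: ip_def g_def scalar_prod_def orthonormal_representation_def V_def lessThan_atLeast0)
  have unit: "ip u u = 1" if "u \<in> V" for u
    using rep that ip[OF that that]
    by (auto simp: orthonormal_representation_def V_def euclidean_norm_def)
  have orth: "ip u v = 0" if "u \<in> V" "v \<in> V" "u \<noteq> v" "(u, v) \<notin> parcs G" for u v
    using rep that ip by (auto simp: orthonormal_representation_def V_def)
  have bound: "(\<Sum>u\<in>V. (ip u v)\<^sup>2) \<le> t - 1" if v: "v \<in> V" for v
  proof -
    define S where "S = {u \<in> V. (v, u) \<in> parcs G}"
    have "finite S" "S \<subseteq> V" and vS: "v \<notin> S" using finV G.no_loops' by (auto simp: S_def)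
    have nopath: "length xs \<le> t - 2"
      if xs: "distinct xs" "set xs \<subseteq> S" "successively (\<lambda>a b. (a, b) \<in> parcs G) xs" for xs
    proof (rule ccontr)
      assume "\<not> length xs \<le> t - 2"
      \<comment> \<open>Truncation to exactly \<open>t - 1\<close> vertices makes
        \<open>v # ys\<close> a cycle of length \<open>t\<close>, since \<open>v\<close> is adjacent
        to both ends of \<open>ys\<close>.\<close>
      define ys where "ys = take (t - 1) xs"
      have len: "length ys = t - 1" using \<open>\<not> length xs \<le> t - 2\<close> by (simp add: ys_def)
      have "distinct ys" and ysS: "set ys \<subseteq> S"
        using xs set_take_subset[of "t - 1" xs] by (auto simp: ys_def)
      have step: "(ys ! i, ys ! Suc i) \<in> parcs G" if "Suc i < t - 1" for i
        using successively_nth[OF xs(3), of i] that len by (simp add: ys_def)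
      have "(v # ys) ! i \<in> pverts G \<and> ((v # ys) ! i, (v # ys) ! (Suc i mod t)) \<in> parcs G"
        if i: "i < t" for i
      proof -
        have in_S: "ys ! j \<in> S" if "j < t - 1" for j using ysS len that by auto
        \<comment> \<open>The arc leaving \<open>v\<close>, an arc inside the path, and the closing
          arc, where \<open>Suc i mod t\<close> wraps to 0.\<close>
        consider "i = 0" | j where "i = Suc j" "Suc i < t" | j where "i = Suc j" "Suc i = t"
          using i Suc_lessI[OF i] by (cases i) blast+
        then show ?thesis
        proof cases
          case 1
          then show ?thesis using v in_S[of 0] t by (auto simp: V_def S_def)
        next
          case 2
          then show ?thesis using step[of j] in_S[of j] by (auto simp: S_def V_def)
        next
          case 3
          then show ?thesis using in_S[of j] G.arcs_symmetric by (auto simp: S_def V_def)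
        qed
      qed
      then have "\<not> H_free (cycle_graph t) G"
        using len t \<open>distinct ys\<close> ysS vS
        by (intro not_H_free_cycle_graphI[OF G, of t "v # ys"]) auto
      with free show False by simp
    qed
    have "\<exists>c. c ` S \<subseteq> {..<t - 2} \<and>
        (\<forall>u\<in>S. \<forall>w\<in>S. u \<noteq> w \<longrightarrow> (u, w) \<in> parcs G \<longrightarrow> c u \<noteq> (c w :: nat))"
      by (intro pathfree_colouring \<open>finite S\<close> nopath) (auto intro: G.arcs_symmetric)
    then obtain c where c: "c ` S \<subseteq> {..<t - 2}"
        "\<And>u w. u \<in> S \<Longrightarrow> w \<in> S \<Longrightarrow> u \<noteq> w \<Longrightarrow> (u, w) \<in> parcs G \<Longrightarrow> c u \<noteq> c w"
      by auto
    have "(\<Sum>u\<in>S. (ip u v)\<^sup>2) = (\<Sum>j<t - 2. \<Sum>u\<in>{u \<in> S. c u = j}. (ip u v)\<^sup>2)"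
      by (rule sum.group[OF \<open>finite S\<close> finite_lessThan c(1), symmetric])
    also have "\<dots> \<le> (\<Sum>j<t - 2. 1)"
    proof (rule sum_mono)
      fix j
      \<comment> \<open>A colour class is independent in \<open>G\<close>, so its vectors are
        orthonormal and Bessel applies to the unit vector of \<open>v\<close>.\<close>
      have "(\<Sum>u\<in>{u \<in> S. c u = j}. (\<Sum>i<d. g u i * g v i)\<^sup>2) \<le> (\<Sum>i<d. (g v i)\<^sup>2)"
      proof (rule bessel_inequality)
        fix u w assume "u \<in> {u \<in> S. c u = j}" "w \<in> {u \<in> S. c u = j}"
        then have "ip u w = (if u = w then 1 else 0)"
          using unit[of u] orth[of u w] c(2)[of u w] \<open>S \<subseteq> V\<close> by auto
        then show "(\<Sum>i<d. g u i * g w i) = (if u = w then 1 else 0)" by (simp add: ip_def)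
      qed (use \<open>finite S\<close> in auto)
      then show "(\<Sum>u\<in>{u \<in> S. c u = j}. (ip u v)\<^sup>2) \<le> 1"
        using unit[OF v] by (simp add: ip_def power2_eq_square)
    qed
    finally have "(\<Sum>u\<in>S. (ip u v)\<^sup>2) \<le> t - 2" by simp
    \<comment> \<open>Vertices outside \<open>insert v S\<close> are not adjacent to
      \<open>v\<close> and contribute 0; \<open>v\<close> itself raises the bound from
      \<open>t - 2\<close> to \<open>t - 1\<close>.\<close>
    moreover have "(\<Sum>u\<in>V. (ip u v)\<^sup>2) = (\<Sum>u\<in>insert v S. (ip u v)\<^sup>2)"
      using finV v \<open>S \<subseteq> V\<close> orth[of _ v] G.arcs_symmetric
      by (intro sum.mono_neutral_right) (auto simp: S_def)
    ultimately show ?thesis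
      using \<open>finite S\<close> vS unit[OF v] t by simp
  qed
  have "real (card V) = (\<Sum>u\<in>V. \<Sum>i<d. (g u i)\<^sup>2)"
    using unit by (simp add: ip_def power2_eq_square)
  then have "(real (card V))\<^sup>2 \<le> real d * (\<Sum>u\<in>V. \<Sum>v\<in>V. (ip u v)\<^sup>2)"
    using welch_bound[of "{..<d}" V g] finV by (simp add: ip_def)
  also have "\<dots> = real d * (\<Sum>v\<in>V. \<Sum>u\<in>V. (ip u v)\<^sup>2)"
    by (subst sum.swap) simp
  also have "\<dots> \<le> real d * (\<Sum>v\<in>V. real (t - 1))"
    using bound by (intro mult_left_mono sum_mono) auto
  finally have "real (card V * card V) \<le> real (d * (t - 1) * card V)"
    by (simp add: power2_eq_square mult_ac)
  then have "card V * card V \<le> d * (t - 1) * card V"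
    unfolding of_nat_le_iff .
  then show ?thesis by (cases "card V = 0") (auto simp: V_def)
qed

section \<open>Extremal graphs\<close>

text \<open>For positive \<open>s\<close>, the cliques are the blocks of \<open>s\<close>
  consecutive numbers, indexed by \<open>u div s\<close>; the last block may be smaller.\<close>

definition clique_union :: "nat \<Rightarrow> nat \<Rightarrow> nat pair_pre_digraph" where
  "clique_union n s = \<lparr>pverts = {..<n},
     parcs = {(u, v). u < n \<and> v < n \<and> u \<noteq> v \<and> u div s = v div s}\<rparr>"

lemma pair_graph_clique_union: "pair_graph (clique_union n s)"
  by (rule finite_pair_graphI) (auto simp: clique_union_def sym_def)

text \<open>Walking along the cycle never leaves a block, so all \<open>t\<close> vertices would
  have to fit into an interval of length \<open>s < t\<close>.\<close>

lemma H_free_clique_union: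
  assumes "0 < s" "s < t"
  shows "H_free (cycle_graph t) (clique_union n s)"
  unfolding H_free_def
proof
  assume "\<exists>K. pair_graph K \<and> subgraph (with_proj K) (with_proj (clique_union n s))
     \<and> digraph_iso (with_proj (cycle_graph t)) (with_proj K)"
  then obtain K f where sub: "subgraph (with_proj K) (with_proj (clique_union n s))"
    and iso: "pre_digraph.digraph_isomorphism (with_proj (cycle_graph t)) f"
    and K: "with_proj K = app_iso f (with_proj (cycle_graph t))"
    unfolding digraph_iso_def by blast
  define h where "h = iso_verts f"
  have inj: "inj_on h {..<t}"
    using iso by (simp add: pre_digraph.digraph_isomorphism_def h_def cycle_graph_def)
  have edge: "h i div s = h (Suc i) div s" if "Suc i < t" for i
  proof -
    have a: "(i, Suc i) \<in> parcs (cycle_graph t)" using that by (simp add: cycle_graph_def)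
    then have "iso_arcs f (i, Suc i) \<in> arcs (with_proj K)" by (simp only: K) simp
    then have "iso_arcs f (i, Suc i) \<in> parcs (clique_union n s)" using sub by (auto simp: subgraph_def)
    \<comment> \<open>Equality of the records identifies the tail and head maps of \<open>f\<close>
      with the projections, so the image of an arc is the pair of images of its ends.\<close>
    moreover have "fst = iso_tail f" "snd = iso_head f"
      using arg_cong[OF K, of tail] arg_cong[OF K, of head] by simp_all
    then have "iso_arcs f (i, Suc i) = (h i, h (Suc i))"
      using iso a unfolding pre_digraph.digraph_isomorphism_def h_def
      by (metis fst_conv prod.collapse snd_conv with_proj_simps(2,4,5))
    ultimately show ?thesis by (simp add: clique_union_def)
  qed
  have "h i div s = h 0 div s" if "i < t" for i
    using that by (induction i) (auto simp: edge[symmetric])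
  then have "h i \<in> {h 0 div s * s..<h 0 div s * s + s}" if "i < t" for i
    unfolding atLeastLessThan_iff using that \<open>0 < s\<close>
    by (metis add.commute div_times_less_eq_dividend dividend_less_div_times)
  then have "h ` {..<t} \<subseteq> {h 0 div s * s..<h 0 div s * s + s}" by blast
  then have "card (h ` {..<t}) \<le> card {h 0 div s * s..<h 0 div s * s + s}"
    by (intro card_mono) auto
  then show False using card_image[OF inj] \<open>s < t\<close> by simp
qed

text \<open>The bound on \<open>n\<close> keeps every block index below \<open>d\<close>, so each
  \<open>unit_vec\<close> involved really has norm 1.\<close>

lemma orthonormal_representation_clique_union:
  assumes "n \<le> d * s"
  shows "orthonormal_representation (clique_union n s) d (\<lambda>u. unit_vec d (u div s))"
proof -
  have "u div s < d" if "u < n" for u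
    using assms that by (simp add: less_mult_imp_div_less)
  then show ?thesis
    by (auto simp: orthonormal_representation_def clique_union_def euclidean_norm_def)
qed

section \<open>Attainment of the minima\<close>

text \<open>Distinct basis vectors for distinct vertices suffice. Existence ensures that the
  \<open>LEAST\<close> in \<open>msr\<close> is attained.\<close>

lemma pair_graph_has_representation:
  assumes "pair_graph G"
  shows "\<exists>d f. orthonormal_representation G d f"
proof -
  interpret G: pair_graph G by fact
  obtain h where h: "bij_betw h (pverts G) {0..<card (pverts G)}"
    using ex_bij_betw_finite_nat[OF G.pair_finite_verts] by blast
  then have "orthonormal_representation G (card (pverts G)) (\<lambda>u. unit_vec (card (pverts G)) (h u))"
    using bij_betwE[OF h] inj_onD[OF bij_betw_imp_inj_on[OF h]]
    by (auto simp: orthonormal_representation_def euclidean_norm_def)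
  then show ?thesis by blast
qed

lemma msr_representation:
  assumes "pair_graph G"
  shows "\<exists>f. orthonormal_representation G (msr G) f"
  unfolding msr_def using pair_graph_has_representation[OF assms] by (rule LeastI_ex)

theorem theorem1p9:
  fixes t n :: nat
  assumes "t \<ge> 3" and "n \<ge> 1"
  shows "int (rho n (cycle_graph t)) = \<lceil>real n / (real t - 1)\<rceil>"
proof -
  define r where "r = nat \<lceil>real n / (real t - 1)\<rceil>"
  have r: "\<lceil>real n / (real t - 1)\<rceil> = int r"
  proof -
    have "0 \<le> real n / (real t - 1)" using assms by simp
    then show ?thesis by (simp add: r_def)
  qed
  \<comment> \<open>This characterises the ceiling by the inequality that both the lower bound and
    the construction speak about.\<close>
  have r_le: "r \<le> m \<longleftrightarrow> n \<le> m * (t - 1)" for m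
  proof -
    have "r \<le> m \<longleftrightarrow> \<lceil>real n / (real t - 1)\<rceil> \<le> int m" using r by simp
    also have "\<dots> \<longleftrightarrow> real n / (real t - 1) \<le> real m" by (simp add: ceiling_le_iff)
    also have "\<dots> \<longleftrightarrow> real n \<le> real m * real (t - 1)" using assms by (simp add: divide_le_eq)
    also have "\<dots> \<longleftrightarrow> n \<le> m * (t - 1)" by (simp flip: of_nat_mult del: of_nat_diff)
    finally show ?thesis .
  qed
  have lower: "r \<le> msr G"
    if "pair_graph G" "card (pverts G) = n" "H_free (cycle_graph t) G" for G :: "nat pair_pre_digraph"
    using msr_representation H_free_cycle_graph_card_le that assms(1) r_le by metis
  let ?G = "clique_union n (t - 1)"
  have G: "pair_graph ?G" "card (pverts ?G) = n" "H_free (cycle_graph t) ?G"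
    using assms pair_graph_clique_union H_free_clique_union by (auto simp: clique_union_def)
  \<comment> \<open>Taking \<open>m = r\<close> in \<open>r_le\<close> gives
    \<open>n \<le> r * (t - 1)\<close>, so \<open>r\<close> basis vectors cover all blocks.\<close>
  have "msr ?G \<le> r"
    unfolding msr_def using orthonormal_representation_clique_union r_le by (intro Least_le) blast
  with lower[OF G] have "msr ?G = r" by simp
  then have "rho n (cycle_graph t) = r"
    unfolding rho_def using G lower by (intro Least_equality) blast+
  then show ?thesis using r by simp
qed

end
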